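(* Let $\mathcal{F}$ be a $3$-uniform linear set system with maximum matching size $\nu(\mathcal{F})=\nu$ and maximum degree $\Delta(\mathcal{F})=\Delta$. If $\Delta\geq \frac{23}{6}\nu\left(1+\frac{1}{\nu-1}\right)$, then $|\mathcal{F}|\leq \Delta\nu$.
   Context: A set system $\mathcal{F}$ is a finite collection of distinct subsets of a vertex set $V$. It is $3$-uniform if every member has exactly $3$ elements, and linear if $|A\cap B|\leq 1$ for all distinct $A,B\in\mathcal{F}$. A matching is a collection of pairwise disjoint members of $\mathcal{F}$; $\nu(\mathcal{F})$ is the maximum size of a matching. For a vertex $x$, $\mathcal{F}_x=\{A\in\mathcal{F}: x\in A\}$, and $\Delta(\mathcal{F})=\max_x|\mathcal{F}_x|$. *)

theory Defs
  imports Complex_Main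
begin

definition uniform3 :: "'a set set \<Rightarrow> bool" where
  "uniform3 F \<longleftrightarrow> (\<forall>A\<in>F. card A = 3)"

definition linear_sys :: "'a set set \<Rightarrow> bool" where
  "linear_sys F \<longleftrightarrow> (\<forall>A\<in>F. \<forall>B\<in>F. A \<noteq> B \<longrightarrow> card (A \<inter> B) \<le> 1)"

definition is_matching :: "'a set set \<Rightarrow> 'a set set \<Rightarrow> bool" where
  "is_matching F M \<longleftrightarrow> M \<subseteq> F \<and> (\<forall>A\<in>M. \<forall>B\<in>M. A \<noteq> B \<longrightarrow> A \<inter> B = {})"

definition matching_number :: "'a set set \<Rightarrow> nat" where
  "matching_number F = Max {card M | M. is_matching F M}"

definition star :: "'a set set \<Rightarrow> 'a \<Rightarrow> 'a set set" where
  "star F x = {A\<in>F. x \<in> A}"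

definition max_degree :: "'a set set \<Rightarrow> nat" where
  "max_degree F = Max ({card (star F x) | x. True} \<union> {0})"

end

theory Submission
  imports Defs
begin

text \<open>
  A vertex of degree greater than \<open>3\<nu>\<close> lies on an edge avoiding any given matching of the
  remaining edges that has \<open>\<nu>\<close> members, so deleting it lowers the matching number. By induction we
  may assume that all degrees are at most \<open>3n\<close>, where \<open>n\<close> is the matching number, and it suffices
  to show \<open>6|F| \<le> 23n(n + 1)\<close>.

  Let \<open>M\<close> be a maximum matching with vertex set \<open>V\<close>. Call an edge private at \<open>u\<close> if it meets \<open>V\<close>
  only in \<open>u\<close>. Since \<open>M\<close> cannot be augmented, a member of \<open>M\<close> either has at most 6 private edges
  (light), or all its private edges are at one vertex, its centre (heavy). With \<open>h\<close> heavy and \<open>l\<close>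
  light members, at most \<open>3nh\<close> edges pass through centres. An edge that avoids the centres
  and meets \<open>V\<close> in two or three vertices is charged to the pairs of members of \<open>M\<close> that it meets:
  weight 1 to its only pair, or \<open>1/3\<close> to each of its three pairs. Augmentation arguments show that a
  heavy-heavy pair gets weight at most \<open>4/3\<close> and a heavy-light pair at most \<open>4 + 2/3\<close>. A light pair
  gets at most \<open>23/3\<close> on average (if \<open>l \<ge> 3\<close>), because the three pairs inside a triple of members of \<open>M\<close> carry
  together at most 21 edges with exactly two vertices in \<open>V\<close>.
\<close>

section \<open>Averaging a bound on triples over pairs\<close>

text \<open>Averaged over all triples, \<open>three\<close> gives 7 per pair. With at most two
  elements there is no triple to use; the bound 8 on each of two ordered pairs exceeds the average
  by 2 in total, whence the summand 2.\<close>

lemma sum_pairs_le_of_triples: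
  fixes t :: "'b \<Rightarrow> 'b \<Rightarrow> nat"
  assumes "finite L" and sym: "\<And>A B. t A B = t B A"
    and two: "\<And>A B. A \<in> L \<Longrightarrow> B \<in> L \<Longrightarrow> A \<noteq> B \<Longrightarrow> t A B \<le> 8"
    and three: "\<And>A B C. A \<in> L \<Longrightarrow> B \<in> L \<Longrightarrow> C \<in> L \<Longrightarrow> A \<noteq> B \<Longrightarrow> A \<noteq> C \<Longrightarrow> B \<noteq> C \<Longrightarrow>
      t A B + t A C + t B C \<le> 21"
  shows "(\<Sum>A\<in>L. \<Sum>B\<in>L - {A}. t A B) \<le> 7 * card L * (card L - 1) + 2"
proof (cases "card L \<le> 2")
  case True
  have "(\<Sum>A\<in>L. \<Sum>B\<in>L - {A}. t A B) \<le> (\<Sum>A\<in>L. \<Sum>B\<in>L - {A}. 8)"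
    using two by (intro sum_mono) auto
  also have "\<dots> = card L * (8 * (card L - 1))" using \<open>finite L\<close> by simp
  also have "\<dots> \<le> 7 * card L * (card L - 1) + 2"
  proof -
    from True consider "card L = 0" | "card L = 1" | "card L = 2" by linarith
    then show ?thesis by cases auto
  qed
  finally show ?thesis .
next
  case False
  then obtain k where k: "card L = k + 2" "k > 0" by (metis add.commute less_imp_add_positive not_le)
  define d where "d A = (\<Sum>B\<in>L - {A}. t A B)" for A
  define S where "S = (\<Sum>A\<in>L. d A)"
  \<comment> \<open>Sum \<open>three\<close> over the \<open>k\<close> choices of \<open>C\<close>.
    Both \<open>d A\<close> and \<open>d B\<close> also contain \<open>t A B\<close>, which accounts
    for \<open>2 * t A B\<close> on the right. Summation over ordered pairs then leaves
    \<open>3 * k * S\<close> on the left, and the positive \<open>k\<close> cancels.\<close>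
  have pair: "k * t A B + d A + d B \<le> 21 * k + 2 * t A B" if "A \<in> L" "B \<in> L - {A}" for A B
  proof -
    have c: "card (L - {A} - {B}) = k" using that k \<open>finite L\<close> by simp
    have "(\<Sum>C\<in>L - {A} - {B}. t A B + t A C + t B C) \<le> (\<Sum>C\<in>L - {A} - {B}. 21)"
      using that by (intro sum_mono three) auto
    then have "k * t A B + (\<Sum>C\<in>L - {A} - {B}. t A C) + (\<Sum>C\<in>L - {A} - {B}. t B C) \<le> 21 * k"
      using c by (simp add: sum.distrib)
    moreover have "d A = t A B + (\<Sum>C\<in>L - {A} - {B}. t A C)"
      unfolding d_def using that \<open>finite L\<close> by (intro sum.remove) auto
    moreover have "d B = t A B + (\<Sum>C\<in>L - {A} - {B}. t B C)"
    proof -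
      have "L - {B} - {A} = L - {A} - {B}" by auto
      moreover have "A \<in> L - {B}" using that by auto
      ultimately show ?thesis
        unfolding d_def using \<open>finite L\<close> sum.remove[of "L - {B}" A "t B"] sym[of B A] by simp
    qed
    ultimately show ?thesis by simp
  qed
  have "(\<Sum>A\<in>L. \<Sum>B\<in>L - {A}. k * t A B + d A + d B) \<le> (\<Sum>A\<in>L. \<Sum>B\<in>L - {A}. 21 * k + 2 * t A B)"
    by (intro sum_mono pair)
  moreover have "(\<Sum>A\<in>L. \<Sum>B\<in>L - {A}. 21 * k + 2 * t A B) = (k + 2) * ((k + 1) * (21 * k)) + 2 * S"
    using k \<open>finite L\<close> by (simp add: sum.distrib S_def d_def sum_distrib_left)
  moreover have "(\<Sum>A\<in>L. \<Sum>B\<in>L - {A}. k * t A B + d A + d B) = k * S + (k + 1) * S + (k + 1) * S"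
  proof -
    have "(\<Sum>A\<in>L. \<Sum>B\<in>L - {A}. d B) + S = (\<Sum>A\<in>L. \<Sum>B\<in>L. d B)"
      unfolding S_def sum.distrib[symmetric]
      using \<open>finite L\<close> by (intro sum.cong) (simp_all add: sum.remove add.commute)
    also have "\<dots> = (k + 2) * S" using k by (simp add: S_def)
    finally have "(\<Sum>A\<in>L. \<Sum>B\<in>L - {A}. d B) = (k + 1) * S" by simp
    then show ?thesis using k \<open>finite L\<close>
      by (simp add: sum.distrib S_def d_def sum_distrib_left)
  qed
  ultimately have "k * (3 * S) \<le> k * (21 * (k + 2) * (k + 1))" by (simp add: algebra_simps)
  then have "3 * S \<le> 21 * (k + 2) * (k + 1)" using k(2) by (simp only: mult_le_cancel1)
  then have "S \<le> 7 * (k + 2) * (k + 1)" by (simp add: algebra_simps)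
  then show ?thesis using k by (simp add: S_def d_def)
qed

section \<open>Maximum matchings and augmentation\<close>

locale maximum_matching =
  fixes F M :: "'a set set"
  assumes finF: "finite F" and uniform: "uniform3 F" and linear: "linear_sys F"
    and matching: "is_matching F M"
    and maximum: "\<And>N. is_matching F N \<Longrightarrow> card N \<le> card M"
begin

definition V where "V = \<Union>M"

text \<open>\<open>R\<close> is a partial proper edge colouring of the complete multipartite graph whose parts are
  the members of \<open>M\<close>: the colour of \<open>uv\<close> is the uncovered vertex \<open>x\<close>.\<close>

definition R where "R u v x \<longleftrightarrow> u \<in> V \<and> v \<in> V \<and> x \<notin> V \<and> {u, v, x} \<in> F"

text \<open>The coloured cells of the array \<open>A \<times> B\<close>. For distinct members
  \<open>A\<close>, \<open>B\<close> of \<open>M\<close>, linearity makes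
  \<open>card (T A B)\<close> the number of edges that meet \<open>V\<close> in exactly two
  vertices, one in each.\<close>

definition T where "T A B = {(u, v). u \<in> A \<and> v \<in> B \<and> (\<exists>x. R u v x)}"

lemma card_edge: "e \<in> F \<Longrightarrow> card e = 3"
  using uniform by (auto simp: uniform3_def)

lemma finite_edge: "e \<in> F \<Longrightarrow> finite e"
  using card_edge by (metis card.infinite zero_neq_numeral)

lemma M_subset: "M \<subseteq> F"
  using matching by (auto simp: is_matching_def)

lemma finite_M: "finite M"
  using M_subset finF finite_subset by blast

lemma finite_V: "finite V"
  using finite_M M_subset finite_edge by (auto simp: V_def)

lemma M_subset_V: "A \<in> M \<Longrightarrow> A \<subseteq> V"
  by (auto simp: V_def)

lemma M_disjoint: "A \<in> M \<Longrightarrow> B \<in> M \<Longrightarrow> A \<noteq> B \<Longrightarrow> A \<inter> B = {}"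
  using matching by (auto simp: is_matching_def)

lemma edge_eqI:
  assumes "e \<in> F" "f \<in> F" "p \<noteq> q" "p \<in> e" "q \<in> e" "p \<in> f" "q \<in> f"
  shows "e = f"
proof (rule ccontr)
  assume "e \<noteq> f"
  then have "card (e \<inter> f) \<le> 1" using linear assms by (auto simp: linear_sys_def)
  moreover have "card {p, q} \<le> card (e \<inter> f)"
    using assms finite_edge by (intro card_mono) auto
  ultimately show False using assms by simp
qed

lemma R_sym: "R u v x \<Longrightarrow> R v u x"
  by (auto simp: R_def insert_commute)

lemma R_neq: assumes "R u v x" shows "u \<noteq> v" "u \<noteq> x" "v \<noteq> x"
proof -
  have "card {u, v, x} = 3" using assms card_edge by (auto simp: R_def)
  then show "u \<noteq> v" "u \<noteq> x" "v \<noteq> x"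
    by (auto simp: card_insert_if split: if_splits)
qed

lemma R_unique:
  assumes "R u v x" "R u v y" shows "x = y"
proof -
  have "{u, v, x} = {u, v, y}"
    using assms R_neq[OF assms(1)] by (intro edge_eqI[of _ _ u v]) (auto simp: R_def)
  then show ?thesis using R_neq[OF assms(1)] by auto
qed

lemma R_inj:
  assumes "R u v x" "R u w x" shows "v = w"
proof -
  have "{u, v, x} = {u, w, x}"
    using assms R_neq[OF assms(1)] by (intro edge_eqI[of _ _ u x]) (auto simp: R_def)
  then show ?thesis using R_neq[OF assms(1)] by auto
qed

lemma R_inj': "R v u x \<Longrightarrow> R w u x \<Longrightarrow> v = w"
  using R_inj R_sym by blast

text \<open>The edges of \<open>N\<close> meet \<open>V\<close> only inside
  \<open>\<Union>K\<close>, hence avoid \<open>M - K\<close>. Exchanging \<open>K\<close> for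
  \<open>N\<close> gives a matching again, which is no larger than \<open>M\<close>.\<close>

lemma no_augmentation:
  assumes "N \<subseteq> F" "K \<subseteq> M" and disj: "\<And>e f. e \<in> N \<Longrightarrow> f \<in> N \<Longrightarrow> e \<noteq> f \<Longrightarrow> e \<inter> f = {}"
    and sub: "\<And>e. e \<in> N \<Longrightarrow> e \<inter> V \<subseteq> \<Union>K"
  shows "card N \<le> card K"
proof -
  have *: "e \<inter> A = {}" if "e \<in> N" "A \<in> M - K" for e A
  proof -
    have "e \<inter> A \<subseteq> \<Union>K \<inter> A" using sub that M_subset_V by blast
    also have "\<dots> = {}" using that \<open>K \<subseteq> M\<close> M_disjoint by blast
    finally show ?thesis by blast
  qed
  have "is_matching F ((M - K) \<union> N)"
    unfolding is_matching_def
  proof (intro conjI ballI impI)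
    show "M - K \<union> N \<subseteq> F" using assms(1) M_subset by blast
    show "A \<inter> B = {}" if "A \<in> M - K \<union> N" "B \<in> M - K \<union> N" "A \<noteq> B" for A B
      using that *[of A B] *[of B A] disj[of A B] M_disjoint[of A B] by blast
  qed
  then have "card ((M - K) \<union> N) \<le> card M" by (rule maximum)
  moreover have "(M - K) \<inter> N = {}"
  proof -
    have "e \<noteq> {}" if "e \<in> N" for e using card_edge[of e] that assms(1) by auto
    then show ?thesis using * by blast
  qed
  ultimately have "card (M - K) + card N \<le> card M"
    using finite_M finF assms(1) finite_subset by (metis card_Un_disjoint finite_Diff)
  moreover have "card (M - K) = card M - card K" "card K \<le> card M"
    using assms(2) finite_M by (auto simp: card_Diff_subset finite_subset card_mono)
  ultimately show ?thesis by simp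
qed

lemma no_augmentation2:
  assumes "e \<in> F" "f \<in> F" "A \<in> M" "e \<inter> V \<subseteq> A" "f \<inter> V \<subseteq> A" "e \<inter> f = {}"
  shows False
proof -
  have "e \<noteq> f" using assms card_edge[of e] by auto
  moreover have "card {e, f} \<le> card {A}"
    by (rule no_augmentation) (use assms in auto)
  ultimately show False by simp
qed

lemma no_augmentation3:
  assumes "e \<in> F" "f \<in> F" "g \<in> F" "A \<in> M" "B \<in> M"
    and "e \<inter> V \<subseteq> A \<union> B" "f \<inter> V \<subseteq> A \<union> B" "g \<inter> V \<subseteq> A \<union> B"
    and "e \<inter> f = {}" "e \<inter> g = {}" "f \<inter> g = {}"
  shows False
proof -
  have "e \<noteq> f" "e \<noteq> g" "f \<noteq> g" using assms card_edge[of e] card_edge[of f] by auto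
  moreover have "card {e, f, g} \<le> card {A, B}"
    by (rule no_augmentation) (use assms in auto)
  moreover have "card {A, B} \<le> 2" by (simp add: card_insert_if)
  ultimately show False by simp
qed

text \<open>Colours lie outside \<open>V\<close>, so vertex-disjoint cells of different colours are
  disjoint edges; three of them could replace \<open>A\<close> and \<open>B\<close>.\<close>

lemma no_rainbow3:
  assumes "R u1 v1 x1" "R u2 v2 x2" "R u3 v3 x3" "A \<in> M" "B \<in> M"
    and "{u1, v1, u2, v2, u3, v3} \<subseteq> A \<union> B"
    and "distinct [u1, v1, u2, v2, u3, v3]" "distinct [x1, x2, x3]"
  shows False
  by (rule no_augmentation3[of "{u1, v1, x1}" "{u2, v2, x2}" "{u3, v3, x3}" A B])
    (use assms in \<open>auto simp: R_def\<close>)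

lemma no_rainbow4:
  assumes R: "R u1 v1 x1" "R u2 v2 x2" "R u3 v3 x3" "R u4 v4 x4"
    and M: "A \<in> M" "B \<in> M" "C \<in> M"
    and sub: "{u1, v1, u2, v2, u3, v3, u4, v4} \<subseteq> A \<union> B \<union> C"
    and d: "distinct [u1, v1, u2, v2, u3, v3, u4, v4]" "distinct [x1, x2, x3, x4]"
  shows False
proof -
  let ?N = "{{u1, v1, x1}, {u2, v2, x2}, {u3, v3, x3}, {u4, v4, x4}}"
  have mem: "u1 \<in> V" "v1 \<in> V" "u2 \<in> V" "v2 \<in> V" "u3 \<in> V" "v3 \<in> V" "u4 \<in> V" "v4 \<in> V"
    "x1 \<notin> V" "x2 \<notin> V" "x3 \<notin> V" "x4 \<notin> V" using R by (auto simp: R_def)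
  have neq: "u \<noteq> x" if "u \<in> V" "x \<notin> V" for u x using that by auto
  have disj: "{u1, v1, x1} \<inter> {u2, v2, x2} = {}" "{u1, v1, x1} \<inter> {u3, v3, x3} = {}"
     "{u1, v1, x1} \<inter> {u4, v4, x4} = {}" "{u2, v2, x2} \<inter> {u3, v3, x3} = {}"
     "{u2, v2, x2} \<inter> {u4, v4, x4} = {}" "{u3, v3, x3} \<inter> {u4, v4, x4} = {}"
    using d mem by (simp_all add: neq neq[symmetric])
  have "card ?N \<le> card {A, B, C}"
  proof (rule no_augmentation)
    show "?N \<subseteq> F" using R by (auto simp: R_def)
    show "{A, B, C} \<subseteq> M" using M by auto
    show "e \<inter> V \<subseteq> \<Union>{A, B, C}" if "e \<in> ?N" for e
    proof -
      have "e \<subseteq> insert x1 (insert x2 (insert x3 (insert x4 (A \<union> B \<union> C))))"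
        using that sub by (elim insertE) simp_all
      then show ?thesis using mem by blast
    qed
    show "e \<inter> f = {}" if "e \<in> ?N" "f \<in> ?N" "e \<noteq> f" for e f
      using that disj by (elim insertE) (simp_all add: Int_commute)
  qed
  moreover have "card {A, B, C} \<le> 3" by (simp add: card_insert_if)
  moreover have "card ?N = 4"
  proof -
    have ne: "insert p e \<noteq> f" if "insert p e \<inter> f = {}" for p and e f :: "'a set" using that by blast
    have "{u1, v1, x1} \<noteq> {u2, v2, x2}" "{u1, v1, x1} \<noteq> {u3, v3, x3}"
     "{u1, v1, x1} \<noteq> {u4, v4, x4}" "{u2, v2, x2} \<noteq> {u3, v3, x3}"
     "{u2, v2, x2} \<noteq> {u4, v4, x4}" "{u3, v3, x3} \<noteq> {u4, v4, x4}"
      by (rule ne disj)+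
    then show ?thesis by simp
  qed
  ultimately show False by simp
qed

section \<open>Edges with exactly two vertices in \<open>V\<close>\<close>

lemma T_subset: "T A B \<subseteq> A \<times> B"
  by (auto simp: T_def)

lemma finite_T: "A \<in> M \<Longrightarrow> B \<in> M \<Longrightarrow> finite (T A B)"
  using T_subset M_subset finite_edge by (meson finite_SigmaI finite_subset subsetD)

lemma card_T_sym: "card (T A B) = card (T B A)"
proof -
  have "T B A = (T A B)\<inverse>" unfolding T_def using R_sym by blast
  then show ?thesis by (simp add: card_inverse)
qed

text \<open>Two disjoint cells of the 3 by 3 array lie in exactly one transversal. Eight cells
  contain four complete transversals, each of which needs a repeated colour, so the eight cells fall
  into four monochromatic pairs, and the pairing is unique up to relabelling.\<close>

lemma eight_cells_structure:
  assumes "A \<in> M" "B \<in> M" "A \<noteq> B" and big: "card (T A B) \<ge> 8"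
  obtains a1 a2 a3 b1 b2 b3 x y z w where
    "A = {a1, a2, a3}" "B = {b1, b2, b3}" "distinct [a1, a2, a3, b1, b2, b3]"
    "distinct [x, y, z, w]"
    "R a1 b1 z" "R a1 b2 x" "R a1 b3 w"
    "R a2 b1 w" "R a2 b2 y" "R a2 b3 x"
    "R a3 b1 y" "R a3 b2 z" "\<nexists>q. R a3 b3 q"
proof -
  have A3: "card A = 3" and B3: "card B = 3" using assms M_subset card_edge by auto
  have fin: "finite A" "finite B" using assms M_subset finite_edge by auto
  have "card (A \<times> B - T A B) \<le> 1"
    using big T_subset[of A B] A3 B3 fin by (subst card_Diff_subset) (use big in \<open>auto simp: card_cartesian_product finite_T assms(1-3)\<close>)
  \<comment> \<open>The corner is the uncoloured cell if there is one, and any cell otherwise;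
    \<open>no33\<close> later shows that it is uncoloured in either case.\<close>
  then obtain a3 b3 where ab: "a3 \<in> A" "b3 \<in> B" "A \<times> B - T A B \<subseteq> {(a3, b3)}"
  proof -
    assume r: "\<And>a3 b3. a3 \<in> A \<Longrightarrow> b3 \<in> B \<Longrightarrow> A \<times> B - T A B \<subseteq> {(a3, b3)} \<Longrightarrow> thesis"
    show thesis
    proof (cases "A \<times> B - T A B = {}")
      case True
      moreover obtain a b where "a \<in> A" "b \<in> B" using A3 B3 by fastforce
      ultimately show thesis using r by blast
    next
      case False
      then have "card (A \<times> B - T A B) = 1"
        using \<open>card (A \<times> B - T A B) \<le> 1\<close> fin by (metis One_nat_def card_eq_0_iff finite_Diff finite_cartesian_product le_Suc_eq le_zero_eq)
      then obtain t where "A \<times> B - T A B = {t}" by (auto simp: card_1_singleton_iff)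
      then show thesis using r by (cases t) auto
    qed
  qed
  have "card (A - {a3}) = 2" "card (B - {b3}) = 2" using A3 B3 ab by auto
  then obtain a1 a2 b1 b2 where ab': "A - {a3} = {a1, a2}" "a1 \<noteq> a2" "B - {b3} = {b1, b2}" "b1 \<noteq> b2"
    by (auto simp: card_2_iff)
  have A: "A = {a1, a2, a3}" and B: "B = {b1, b2, b3}" using ab ab' by auto
  have dA: "distinct [a1, a2, a3]" and dB: "distinct [b1, b2, b3]" using ab' by auto
  have d: "distinct [a1, a2, a3, b1, b2, b3]"
    using dA dB M_disjoint[OF assms(1-3)] unfolding A B by auto
  have "\<exists>x. R a b x" if "a \<in> A" "b \<in> B" "(a, b) \<noteq> (a3, b3)" for a b
    using that ab(3) by (auto simp: T_def)
  then have "\<exists>x. R a1 b1 x" "\<exists>x. R a1 b2 x" "\<exists>x. R a1 b3 x" "\<exists>x. R a2 b1 x" "\<exists>x. R a2 b2 x" "\<exists>x. R a2 b3 x"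
    "\<exists>x. R a3 b1 x" "\<exists>x. R a3 b2 x" using d unfolding A B by auto
  then obtain c11 c12 c13 c21 c22 c23 c31 c32 where c:
    "R a1 b1 c11" "R a1 b2 c12" "R a1 b3 c13" "R a2 b1 c21" "R a2 b2 c22" "R a2 b3 c23"
    "R a3 b1 c31" "R a3 b2 c32" by blast
  have row: "p \<noteq> q" if "R u v p" "R u t q" "v \<noteq> t" for u v t p q using that R_inj by blast
  have col: "p \<noteq> q" if "R v u p" "R t u q" "v \<noteq> t" for u v t p q using that R_inj' by blast
  have ne: "c11 \<noteq> c12" "c11 \<noteq> c13" "c12 \<noteq> c13" "c21 \<noteq> c22" "c21 \<noteq> c23" "c22 \<noteq> c23" "c31 \<noteq> c32"
    "c11 \<noteq> c21" "c11 \<noteq> c31" "c21 \<noteq> c31" "c12 \<noteq> c22" "c12 \<noteq> c32" "c22 \<noteq> c32" "c13 \<noteq> c23"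
    using row[OF c(1) c(2)] row[OF c(1) c(3)] row[OF c(2) c(3)] row[OF c(4) c(5)] row[OF c(4) c(6)]
      row[OF c(5) c(6)] row[OF c(7) c(8)] col[OF c(1) c(4)] col[OF c(1) c(7)] col[OF c(4) c(7)]
      col[OF c(2) c(5)] col[OF c(2) c(8)] col[OF c(5) c(8)] col[OF c(3) c(6)] dA dB by simp_all
  have rb: "p = q \<or> p = r \<or> q = r"
    if "R a1 u p" "R a2 v q" "R a3 t r" "distinct [u, v, t]" "{u, v, t} \<subseteq> B" for u v t p q r
    using no_rainbow3[OF that(1-3) assms(1,2)] that d unfolding A B by auto
  \<comment> \<open>The four transversals that avoid the corner: each repeats a colour.\<close>
  have pm: "c12 = c23 \<or> c12 = c31 \<or> c23 = c31" "c13 = c22 \<or> c13 = c31 \<or> c22 = c31"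
    "c11 = c23 \<or> c11 = c32 \<or> c23 = c32" "c13 = c21 \<or> c13 = c32 \<or> c21 = c32"
    using rb[OF c(2) c(6) c(7)] rb[OF c(3) c(5) c(7)] rb[OF c(1) c(6) c(8)] rb[OF c(3) c(4) c(8)] dB
    unfolding B by auto
  \<comment> \<open>On the two transversals through the corner, \<open>q\<close> itself has to be
    the repeated colour, so it lies in \<open>{c11, c22}\<close> and in \<open>{c12, c21}\<close>.
    One of these sets is \<open>{c31, c32}\<close>, the colours in the row of the corner, which
    \<open>q\<close> avoids.\<close>
  have no33: "\<nexists>q. R a3 b3 q" if "c11 \<noteq> c22" "c12 \<noteq> c21" "{c31, c32} = {c11, c22} \<or> {c31, c32} = {c12, c21}"
  proof
    assume "\<exists>q. R a3 b3 q"
    then obtain q where q: "R a3 b3 q" by blast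
    have "q \<noteq> c31" "q \<noteq> c32" using q c dB R_inj by (metis distinct_length_2_or_more)+
    moreover have "c11 = c22 \<or> c11 = q \<or> c22 = q" "c12 = c21 \<or> c12 = q \<or> c21 = q"
      using rb[OF c(1) c(5) q] rb[OF c(2) c(4) q] dB unfolding B by auto
    ultimately show False using that by auto
  qed
  \<comment> \<open>The two possible pairings differ by exchanging \<open>a1\<close> and
    \<open>a2\<close>.\<close>
  have "(c12 = c23 \<and> c22 = c31 \<and> c11 = c32 \<and> c13 = c21) \<or>
        (c12 = c31 \<and> c22 = c13 \<and> c21 = c32 \<and> c11 = c23)"
    using ne pm by argo
  then show thesis
  proof
    assume s: "c12 = c23 \<and> c22 = c31 \<and> c11 = c32 \<and> c13 = c21"
    show thesis
    proof (rule that[OF A B d, of c12 c22 c11 c13])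
      show "distinct [c12, c22, c11, c13]" using s ne by auto
      show "\<nexists>q. R a3 b3 q" by (rule no33) (use s ne in auto)
    qed (use s c in auto)
  next
    assume s: "c12 = c31 \<and> c22 = c13 \<and> c21 = c32 \<and> c11 = c23"
    show thesis
    proof (rule that[of a2 a1 a3 b1 b2 b3 c22 c12 c21 c11])
      show "distinct [c22, c12, c21, c11]" using s ne by auto
      show "\<nexists>q. R a3 b3 q" by (rule no33) (use s ne in auto)
    qed (use s c A B d in auto)
  qed
qed

text \<open>Eight coloured cells already force the ninth to be uncoloured.\<close>

lemma card_T_le_8:
  assumes "A \<in> M" "B \<in> M" "A \<noteq> B"
  shows "card (T A B) \<le> 8"
proof (cases "card (T A B) \<ge> 8")
  case True
  from eight_cells_structure[OF assms True]
  obtain a b where ab: "a \<in> A" "b \<in> B" "\<nexists>q. R a b q" by (metis insertCI)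
  have "card A = 3" "card B = 3" "finite A" "finite B" using assms M_subset card_edge finite_edge by auto
  moreover have "T A B \<subseteq> A \<times> B - {(a, b)}" using T_subset ab by (auto simp: T_def)
  ultimately have "card (T A B) \<le> card (A \<times> B - {(a, b)})" by (intro card_mono) auto
  then show ?thesis using ab \<open>card A = 3\<close> \<open>card B = 3\<close> by (simp add: card_Diff_singleton_if card_cartesian_product)
qed simp

text \<open>Each of the four colours of a full pair \<open>A\<close>, \<open>B\<close> misses only one vertex of \<open>A\<close> and one of \<open>B\<close>, so
  it occurs at most twice between \<open>A \<union> B\<close> and \<open>C\<close>. The edges in new colours (\<open>N\<close>) must therefore be
  numerous, but any two of them, one at \<open>a \<in> A\<close> and one at \<open>b \<in> B\<close>, with distinct ends in \<open>C\<close> and distinct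
  colours extend by two rainbow edges between \<open>A - {a}\<close> and \<open>B - {b}\<close> to a forbidden rainbow matching.\<close>

lemma full_pair_bound:
  assumes M: "A \<in> M" "B \<in> M" "C \<in> M" and ne: "A \<noteq> B" "A \<noteq> C" "B \<noteq> C"
    and big: "card (T A B) \<ge> 8"
  shows "card (T A C) + card (T B C) \<le> 13"
proof (rule ccontr)
  assume "\<not> ?thesis"
  then have sum14: "card (T A C) + card (T B C) \<ge> 14" by simp
  obtain a1 a2 a3 b1 b2 b3 x y z w where
    A: "A = {a1, a2, a3}" and B: "B = {b1, b2, b3}" and d: "distinct [a1, a2, a3, b1, b2, b3]"
    and dc: "distinct [x, y, z, w]"
    and c: "R a1 b1 z" "R a1 b2 x" "R a1 b3 w"
    "R a2 b1 w" "R a2 b2 y" "R a2 b3 x"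
    "R a3 b1 y" "R a3 b2 z" and "\<nexists>q. R a3 b3 q"
    by (rule eight_cells_structure[OF M(1,2) ne(1) big]) (rule that)
  define K where "K = {x, y, z, w}"
  define X where "X U = {(u, v, p). u \<in> U \<and> v \<in> C \<and> R u v p}" for U
  define N where "N U = {(u, v, p) \<in> X U. p \<notin> K}" for U
  have disj: "A \<inter> B = {}" "A \<inter> C = {}" "B \<inter> C = {}" using M ne M_disjoint by auto
  have fin: "finite A" "finite B" "finite C" using M M_subset finite_edge by auto
  have cardX: "card (X U) = card (T U C)" and finX: "finite (X U)" if "U \<in> M" for U
  proof -
    have im: "T U C = (\<lambda>(u, v, p). (u, v)) ` X U"
      by (force simp: T_def X_def)
    have inj: "inj_on (\<lambda>(u, v, p). (u, v)) (X U)"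
      by (auto simp: inj_on_def X_def intro: R_unique)
    show "card (X U) = card (T U C)" unfolding im using inj by (simp add: card_image)
    show "finite (X U)" using finite_T[OF that M(3)] inj unfolding im by (simp add: finite_image_iff)
  qed
  note [simp] = finX[OF M(1)] finX[OF M(2)]
  have finN[simp]: "finite (N A)" "finite (N B)" unfolding N_def by (auto intro: finite_subset[OF _ finX] M)
  have X_split: "card (X U) \<le> card (N U) + card (X U - N U)" for U
  proof -
    have "N U \<union> (X U - N U) = X U" by (auto simp: N_def)
    then show ?thesis using card_Un_le[of "N U" "X U - N U"] by simp
  qed
  \<comment> \<open>By \<open>R_inj\<close> a vertex and a colour determine the other end, so edges
    in old colours are counted by pairs \<open>(u, p)\<close>.\<close>
  have old: "card (X U - N U) \<le> card Y" if "finite Y" "\<And>u v p. (u, v, p) \<in> X U \<Longrightarrow> p \<in> K \<Longrightarrow> (u, p) \<in> Y" for U Y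
  proof (rule card_inj_on_le)
    show "inj_on (\<lambda>(u, v, p). (u, p)) (X U - N U)" by (auto simp: inj_on_def X_def intro: R_inj)
    show "(\<lambda>(u, v, p). (u, p)) ` (X U - N U) \<subseteq> Y" using that(2) by (auto simp: N_def)
  qed fact
  have notAB: "\<not> R u v p" if "R u v' p" "v \<in> C" "v' \<notin> C" for u v v' p
    using that R_inj by blast
  have notC: "a1 \<notin> C" "a2 \<notin> C" "a3 \<notin> C" "b1 \<notin> C" "b2 \<notin> C" "b3 \<notin> C"
    using disj A B by auto
  \<comment> \<open>A colour joining \<open>u\<close> to \<open>B\<close> cannot also join it to
    \<open>C\<close>. In the array \<open>a1\<close> and \<open>a2\<close> miss one colour each, and
    \<open>a3\<close> misses two; the same happens for \<open>b1\<close>, \<open>b2\<close>,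
    \<open>b3\<close>.\<close>
  have oldA': "(u, p) \<in> {(a1, y), (a2, z), (a3, x), (a3, w)}" if "(u, v, p) \<in> X A" "p \<in> K" for u v p
    using that c[THEN notAB] notC by (auto simp: X_def K_def A)
  have oldB': "(u, p) \<in> {(b1, x), (b2, w), (b3, y), (b3, z)}" if "(u, v, p) \<in> X B" "p \<in> K" for u v p
    using that c[THEN R_sym, THEN notAB] notC by (auto simp: X_def K_def B)
  have oldA: "card (X A - N A) \<le> 4"
    by (rule order_trans[OF old[OF _ oldA']]) (auto simp: card_insert_if)
  have oldB: "card (X B - N B) \<le> 4"
    by (rule order_trans[OF old[OF _ oldB']]) (auto simp: card_insert_if)
  have pair: "\<exists>u v u' v' s t. u \<in> A - {a} \<and> u' \<in> A - {a} \<and> v \<in> B - {b} \<and> v' \<in> B - {b} \<and>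
      u \<noteq> u' \<and> v \<noteq> v' \<and> s \<noteq> t \<and> s \<in> K \<and> t \<in> K \<and> R u v s \<and> R u' v' t"
    if ab: "a \<in> A" "b \<in> B" for a b
  proof -
    have r: ?thesis if "R u v s" "R u' v' t" "u \<in> A - {a}" "u' \<in> A - {a}" "v \<in> B - {b}" "v' \<in> B - {b}"
      "u \<noteq> u'" "v \<noteq> v'" "s \<noteq> t" "s \<in> K" "t \<in> K" for u v u' v' s t
      using that by blast
    have K: "x \<in> K" "y \<in> K" "z \<in> K" "w \<in> K" by (auto simp: K_def)
    from ab consider "a = a1" "b = b1" | "a = a1" "b = b2" | "a = a1" "b = b3"
      | "a = a2" "b = b1" | "a = a2" "b = b2" | "a = a2" "b = b3"
      | "a = a3" "b = b1" | "a = a3" "b = b2" | "a = a3" "b = b3" unfolding A B by blast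
    then show ?thesis
    proof cases
      case 1 show ?thesis by (rule r[OF c(6) c(8)]) (use 1 d dc K in \<open>auto simp: A B\<close>)
    next
      case 2 show ?thesis by (rule r[OF c(6) c(7)]) (use 2 d dc K in \<open>auto simp: A B\<close>)
    next
      case 3 show ?thesis by (rule r[OF c(4) c(8)]) (use 3 d dc K in \<open>auto simp: A B\<close>)
    next
      case 4 show ?thesis by (rule r[OF c(3) c(8)]) (use 4 d dc K in \<open>auto simp: A B\<close>)
    next
      case 5 show ?thesis by (rule r[OF c(3) c(7)]) (use 5 d dc K in \<open>auto simp: A B\<close>)
    next
      case 6 show ?thesis by (rule r[OF c(2) c(7)]) (use 6 d dc K in \<open>auto simp: A B\<close>)
    next
      case 7 show ?thesis by (rule r[OF c(3) c(5)]) (use 7 d dc K in \<open>auto simp: A B\<close>)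
    next
      case 8 show ?thesis by (rule r[OF c(1) c(6)]) (use 8 d dc K in \<open>auto simp: A B\<close>)
    next
      case 9 show ?thesis by (rule r[OF c(1) c(5)]) (use 9 d dc K in \<open>auto simp: A B\<close>)
    qed
  qed
  have key: "p = q" if e: "(a, v, p) \<in> N A" and f: "(b, v', q) \<in> N B" and "v \<noteq> v'" for a b v v' p q
  proof (rule ccontr)
    assume "p \<noteq> q"
    have m: "a \<in> A" "b \<in> B" "v \<in> C" "v' \<in> C" "R a v p" "R b v' q" "p \<notin> K" "q \<notin> K"
      using e f by (auto simp: N_def X_def)
    obtain u1 v1 u2 v2 s t where r: "u1 \<in> A - {a}" "u2 \<in> A - {a}" "v1 \<in> B - {b}" "v2 \<in> B - {b}"
      "u1 \<noteq> u2" "v1 \<noteq> v2" "s \<noteq> t" "s \<in> K" "t \<in> K" "R u1 v1 s" "R u2 v2 t" using pair[OF m(1,2)] by blast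
    show False
    proof (rule no_rainbow4[OF r(10,11) m(5,6) M])
      show "distinct [u1, v1, u2, v2, a, v, b, v']" using r m disj \<open>v \<noteq> v'\<close> by auto
      show "distinct [s, t, p, q]" using r m \<open>p \<noteq> q\<close> by auto
    qed (use r m in auto)
  qed
  have "card (T A C) \<le> 8" "card (T B C) \<le> 8" using card_T_le_8 M ne by auto
  \<comment> \<open>Each side has at least 14 - 8 = 6 edges to \<open>C\<close>, of which at most 4
    are in old colours.\<close>
  then have N2: "card (N A) \<ge> 2" "card (N B) \<ge> 2" and N6: "card (N A) + card (N B) \<ge> 6"
    using sum14 cardX[OF M(1)] cardX[OF M(2)] X_split[of A] X_split[of B] oldA oldB by linarith+
  have uniq: "u = u'" if "(u, v, p) \<in> N A \<union> N B" "(u', v, p) \<in> N A \<union> N B" for u u' v p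
    using that R_inj' by (auto simp: N_def X_def)
  have AB_False: False if "(u, v, p) \<in> N A" "(u, v', p') \<in> N B" for u v p v' p'
    using that disj by (auto simp: N_def X_def)
  \<comment> \<open>All new edges end in one vertex of \<open>C\<close>. Otherwise \<open>e\<close>
    and \<open>f\<close> have one colour by \<open>key\<close>, every other new edge at
    \<open>B\<close> ends in \<open>v\<close> and every other one at \<open>A\<close> in
    \<open>v'\<close>. A further use of \<open>key\<close> gives these others one colour, so each
    side has at most two new edges, against \<open>N6\<close>.\<close>
  have same: "v = v'" if e: "(a, v, p) \<in> N A" and f: "(b, v', q) \<in> N B" for a v p b v' q
  proof (rule ccontr)
    assume vv: "v \<noteq> v'"
    have pq: "q = p" using key[OF e f vv] by simp
    have other: "\<exists>e'\<in>S. e' \<noteq> e" if "card S \<ge> 2" for S and e :: "'a \<times> 'a \<times> 'a"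
    proof (rule ccontr)
      assume "\<not> ?thesis"
      then have "S \<subseteq> {e}" by auto
      then have "card S \<le> 1" by (metis card.empty card_insert_le_m1 card_mono finite.emptyI finite.insertI is_singletonI is_singleton_altdef)
      then show False using that by simp
    qed
    \<comment> \<open>If not, the colour \<open>p\<close> occurs at \<open>v\<close>,
      \<open>v'\<close>, \<open>v2\<close> and, through a second new edge at \<open>A\<close>, at a
      fourth vertex of \<open>C\<close>.\<close>
    have B1: "v2 = v" if g: "(b2, v2, p2) \<in> N B" "(b2, v2, p2) \<noteq> (b, v', q)" for b2 v2 p2
    proof (rule ccontr)
      assume "v2 \<noteq> v"
      then have p2: "p2 = p" using key[OF e g(1)] by auto
      have v2: "v2 \<noteq> v'" using uniq[of b2 v2 p2 b] g f pq p2 by auto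
      obtain a3 v3 p3 where h: "(a3, v3, p3) \<in> N A" "(a3, v3, p3) \<noteq> (a, v, p)"
        using other[OF N2(1), of "(a, v, p)"] by auto
      have "p3 = p" using key[OF h(1) f] key[OF h(1) g(1)] v2 pq p2 by metis
      have "v3 \<noteq> v" using h e uniq[of a3 v3 p3 a] \<open>p3 = p\<close> by auto
      have "v3 \<noteq> v'" using h f uniq[of a3 v3 p3 b] \<open>p3 = p\<close> pq AB_False by blast
      have "v3 \<noteq> v2" using h g uniq[of a3 v3 p3 b2] \<open>p3 = p\<close> p2 AB_False by blast
      have "{v, v', v2, v3} \<subseteq> C" using e f g h by (auto simp: N_def X_def)
      then have "card {v, v', v2, v3} \<le> card C" using fin by (intro card_mono)
      then show False using card_edge[of C] M M_subset vv v2 \<open>v2 \<noteq> v\<close> \<open>v3 \<noteq> v\<close> \<open>v3 \<noteq> v'\<close> \<open>v3 \<noteq> v2\<close>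
        by (auto simp: card_insert_if split: if_splits)
    qed
    have A1: "v2 = v'" if g: "(a2, v2, p2) \<in> N A" "(a2, v2, p2) \<noteq> (a, v, p)" for a2 v2 p2
    proof (rule ccontr)
      assume "v2 \<noteq> v'"
      then have p2: "p2 = p" using key[OF g(1) f] pq by auto
      have v2: "v2 \<noteq> v" using uniq[of a2 v2 p2 a] g e pq p2 by auto
      obtain a3 v3 p3 where h: "(a3, v3, p3) \<in> N B" "(a3, v3, p3) \<noteq> (b, v', q)"
        using other[OF N2(2), of "(b, v', q)"] by auto
      have "v3 = v" using B1 h by blast
      then have "p3 = p" using key[OF g(1) h(1)] v2 p2 by auto
      then show False using h e uniq[of a3 v3 p3 a] \<open>v3 = v\<close> AB_False by blast
    qed
    obtain a2 v2 p2 where g: "(a2, v2, p2) \<in> N A" "(a2, v2, p2) \<noteq> (a, v, p)"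
      using other[OF N2(1), of "(a, v, p)"] by auto
    obtain b2 v3 p3 where h: "(b2, v3, p3) \<in> N B" "(b2, v3, p3) \<noteq> (b, v', q)"
      using other[OF N2(2), of "(b, v', q)"] by auto
    have "N A \<subseteq> {(a, v, p), (a2, v2, p2)}"
    proof
      fix t assume t: "t \<in> N A"
      obtain a4 v4 p4 where t4: "t = (a4, v4, p4)" by (cases t)
      show "t \<in> {(a, v, p), (a2, v2, p2)}"
      proof (cases "t = (a, v, p)")
        case False
        then have "v4 = v'" using A1 t t4 by blast
        moreover have "v2 = v'" "v3 = v" using A1[OF g] B1[OF h] by simp_all
        moreover have "p4 = p3" "p2 = p3" using key[OF t[unfolded t4] h(1)] key[OF g(1) h(1)] calculation vv by simp_all
        ultimately show ?thesis using uniq[of a4 v4 p4 a2] t g t4 by auto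
      qed simp
    qed
    then have "card (N A) \<le> card {(a, v, p), (a2, v2, p2)}" by (intro card_mono) auto
    moreover have "N B \<subseteq> {(b, v', q), (b2, v3, p3)}"
    proof
      fix t assume t: "t \<in> N B"
      obtain a4 v4 p4 where t4: "t = (a4, v4, p4)" by (cases t)
      show "t \<in> {(b, v', q), (b2, v3, p3)}"
      proof (cases "t = (b, v', q)")
        case False
        then have "v4 = v" using B1 t t4 by blast
        moreover have "v2 = v'" "v3 = v" using A1[OF g] B1[OF h] by simp_all
        moreover have "p2 = p4" "p2 = p3" using key[OF g(1) t[unfolded t4]] key[OF g(1) h(1)] calculation vv by simp_all
        ultimately show ?thesis using uniq[of a4 v4 p4 b2] t h t4 by auto
      qed simp
    qed
    then have "card (N B) \<le> card {(b, v', q), (b2, v3, p3)}" by (intro card_mono) auto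
    ultimately show False using N6 by (auto simp: card_insert_if split: if_splits)
  qed
  obtain a v p where e: "(a, v, p) \<in> N A" using N2(1) by (cases "N A = {}") auto
  obtain b v' q where f: "(b, v', q) \<in> N B" using N2(2) by (cases "N B = {}") auto
  have atv: "v2 = v" if "(u, v2, r) \<in> N A \<union> N B" for u v2 r
    using that same[OF e f] same[OF e, of u v2 r] same[OF _ f, of u v2 r] by auto
  have vC: "v \<in> C" using e by (auto simp: N_def X_def)
  let ?\<pi> = "\<lambda>(u, v, p). (u, v)"
  have inj: "inj_on ?\<pi> (N A \<union> N B)" by (auto simp: inj_on_def N_def X_def intro: R_unique)
  have sub: "?\<pi> ` (N A \<union> N B) \<subseteq> (A \<union> B) \<times> {v}" using atv by (auto simp: N_def X_def)
  have "N A \<inter> N B = {}" using AB_False by fastforce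
  then have cN: "card (?\<pi> ` (N A \<union> N B)) = card (N A) + card (N B)"
    using inj by (simp add: card_image card_Un_disjoint)
  have cAB: "card ((A \<union> B) \<times> {v}) = 6" using d by (auto simp: A B card_insert_if)
  have le6: "card (N A) + card (N B) \<le> 6"
    using card_mono[OF _ sub] fin cN cAB by simp
  \<comment> \<open>By \<open>N6\<close> all six cells in the column of \<open>v\<close> are filled
    with new colours, in particular those of \<open>a1\<close> and \<open>b1\<close>.\<close>
  have "?\<pi> ` (N A \<union> N B) = (A \<union> B) \<times> {v}"
    using fin cN cAB N6 by (intro card_seteq sub) auto
  then have all: "\<exists>r. (u, v, r) \<in> N A \<union> N B" if "u \<in> A \<union> B" for u
  proof -
    have "(u, v) \<in> ?\<pi> ` (N A \<union> N B)" unfolding \<open>?\<pi> ` (N A \<union> N B) = _\<close> using that by simp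
    then show ?thesis by auto
  qed
  obtain q1 where "(b1, v, q1) \<in> N A \<union> N B" using all[of b1] B by auto
  then have q1: "R b1 v q1" "q1 \<notin> K" by (auto simp: N_def X_def)
  obtain r1 where "(a1, v, r1) \<in> N A \<union> N B" using all[of a1] A by auto
  then have r1: "R a1 v r1" "r1 \<notin> K" by (auto simp: N_def X_def)
  \<comment> \<open>The cell of \<open>a1\<close> and \<open>v\<close> has a new colour, so an edge
    of colour \<open>y\<close> at \<open>a1\<close> ends elsewhere in \<open>C\<close>. With the new
    edge at \<open>b1\<close> and the colours \<open>x\<close>, \<open>z\<close> it forms a rainbow
    matching. Hence \<open>(a1, y)\<close> leaves the list of old edges and the total is at most 6 +
    3 + 4 = 13.\<close>
  have noy: False if "R a1 v2 y" "v2 \<in> C" for v2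
  proof -
    have "v2 \<noteq> v" using that r1 R_unique[of a1 v y r1] by (auto simp: K_def)
    show False
    proof (rule no_rainbow4[OF c(6) c(8) that(1) q1(1) M])
      show "distinct [a2, b3, a3, b2, a1, v2, b1, v]" using d notC that vC \<open>v2 \<noteq> v\<close> by auto
      show "distinct [x, z, y, q1]" using dc q1 by (auto simp: K_def)
    qed (use A B that vC in auto)
  qed
  have "card (X A - N A) \<le> card {(a2, z), (a3, x), (a3, w)}"
  proof (rule old)
    show "(u, p) \<in> {(a2, z), (a3, x), (a3, w)}" if "(u, v, p) \<in> X A" "p \<in> K" for u v p
      using oldA'[OF that] that noy by (auto simp: X_def)
  qed simp
  then have "card (X A - N A) \<le> 3" by (auto simp: card_insert_if split: if_splits)
  then show False
    using sum14 cardX[OF M(1)] cardX[OF M(2)] X_split[of A] X_split[of B] le6 oldB by linarith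
qed

text \<open>Either no pair is full and each contributes at most 7, or one contributes 8 and the
  other two at most 13 together.\<close>

lemma card_T_triple:
  assumes M: "A \<in> M" "B \<in> M" "C \<in> M" and ne: "A \<noteq> B" "A \<noteq> C" "B \<noteq> C"
  shows "card (T A B) + card (T A C) + card (T B C) \<le> 21"
proof -
  have 8: "card (T A B) \<le> 8" "card (T A C) \<le> 8" "card (T B C) \<le> 8" using card_T_le_8 assms by auto
  show ?thesis
    using full_pair_bound[OF M ne] full_pair_bound[OF M(1,3,2) ne(2,1) ne(3)[symmetric]]
      full_pair_bound[OF M(2,3,1) ne(3) ne(1)[symmetric] ne(2)[symmetric]] 8
      card_T_sym[of B A] card_T_sym[of C A] card_T_sym[of C B] by linarith
qed

section \<open>Private edges\<close>

definition P where "P u = {e \<in> F. e \<inter> V = {u}}"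

text \<open>The threshold 5 is what \<open>T_heavy_heavy\<close> needs: a private edge has to avoid another private
  edge and one further vertex. It still leaves at most 6 private edges at a member of \<open>M\<close> that
  is disjoint from \<open>Z\<close>.\<close>

definition Z where "Z = {u \<in> V. card (P u) \<ge> 5}"

lemma finite_P: "finite (P u)"
  using finF by (auto simp: P_def)

text \<open>By linearity two edges through \<open>u\<close> share no other vertex, so each point of
  \<open>S\<close> spoils at most one private edge.\<close>

lemma private_avoiding:
  assumes "finite S" "u \<notin> S" "card S < card (P u)"
  obtains e where "e \<in> P u" "e \<inter> S = {}"
proof (rule ccontr)
  assume "\<not> thesis"
  then have meet: "\<forall>e\<in>P u. \<exists>s. s \<in> e \<inter> S" using that by blast
  then obtain g where g: "\<And>e. e \<in> P u \<Longrightarrow> g e \<in> e \<inter> S" by metis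
  have "inj_on g (P u)"
  proof (rule inj_onI)
    fix e f assume ef: "e \<in> P u" "f \<in> P u" "g e = g f"
    have "g e \<noteq> u" using g[OF ef(1)] assms(2) by auto
    then show "e = f" using g[OF ef(1)] g[OF ef(2)] ef
      by (intro edge_eqI[of e f "g e" u]) (auto simp: P_def)
  qed
  then have "card (P u) \<le> card S" using g assms(1) by (intro card_inj_on_le[of g]) auto
  then show False using assms(3) by simp
qed

text \<open>An edge private at \<open>v\<close> has two further vertices. One of three private edges
  at \<open>u\<close> avoids both, and the two edges together would replace
  \<open>A\<close>.\<close>

lemma private_exclusive:
  assumes "A \<in> M" "u \<in> A" "v \<in> A" "u \<noteq> v" "card (P u) \<ge> 3"
  shows "P v = {}"
proof (rule ccontr)
  assume "P v \<noteq> {}"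
  then obtain f where f: "f \<in> P v" by blast
  have fF: "f \<in> F" "v \<in> f" "f \<inter> V = {v}" using f by (auto simp: P_def)
  have "u \<in> V" "v \<in> V" using assms M_subset_V by auto
  have "card (f - {v}) = 2" using card_edge[OF fF(1)] fF finite_edge[OF fF(1)] by simp
  moreover have "u \<notin> f - {v}" using fF assms \<open>u \<in> V\<close> by auto
  ultimately obtain e where e: "e \<in> P u" "e \<inter> (f - {v}) = {}"
    using private_avoiding[of "f - {v}" u] assms(5) finite_edge[OF fF(1)] by auto
  have eF: "e \<in> F" "e \<inter> V = {u}" using e by (auto simp: P_def)
  have "v \<notin> e" using eF assms(4) \<open>v \<in> V\<close> by auto
  show False
    by (rule no_augmentation2[OF eF(1) fF(1) assms(1)]) (use e fF eF assms \<open>v \<notin> e\<close> in auto)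
qed

text \<open>If some vertex has at least 3 private edges, it has all those of \<open>A\<close>, and
  at most 4 as it is not in \<open>Z\<close>. Otherwise each of the three vertices has at most
  2.\<close>

lemma private_light:
  assumes "A \<in> M" "A \<inter> Z = {}"
  shows "(\<Sum>u\<in>A. card (P u)) \<le> 6"
proof -
  have A: "card A = 3" "finite A" using assms M_subset card_edge finite_edge by auto
  show ?thesis
  proof (cases "\<exists>u\<in>A. card (P u) \<ge> 3")
    case True
    then obtain u where u: "u \<in> A" "card (P u) \<ge> 3" by blast
    have "(\<Sum>u\<in>A. card (P u)) = card (P u) + (\<Sum>v\<in>A - {u}. card (P v))"
      using u A by (intro sum.remove)
    also have "(\<Sum>v\<in>A - {u}. card (P v)) = 0"
    proof (rule sum.neutral, rule ballI)
      fix v assume "v \<in> A - {u}"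
      then show "card (P v) = 0" using private_exclusive[OF assms(1) u(1) _ _ u(2), of v] by auto
    qed
    finally show ?thesis using assms u M_subset_V[OF assms(1)] by (fastforce simp: Z_def)
  next
    case False
    then have "(\<Sum>u\<in>A. card (P u)) \<le> (\<Sum>u\<in>A. 2)" by (intro sum_mono) force
    then show ?thesis using A by simp
  qed
qed

lemma card_M_Z_le_1:
  assumes "A \<in> M" shows "card (A \<inter> Z) \<le> 1"
proof -
  have "u = v" if "u \<in> A \<inter> Z" "v \<in> A \<inter> Z" for u v
    using private_exclusive[OF assms, of u v] that by (force simp: Z_def)
  then show ?thesis using assms M_subset finite_edge by (intro card_le_Suc0_iff_eq[THEN iffD2, unfolded One_nat_def[symmetric]]) auto
qed

lemma private_heavy:
  assumes "A \<in> M" "A \<inter> Z \<noteq> {}" "v \<in> A" "v \<notin> Z"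
  shows "P v = {}"
proof -
  obtain u where "u \<in> A" "u \<in> Z" using assms by blast
  then show ?thesis using private_exclusive[OF assms(1), of u v] assms by (auto simp: Z_def)
qed

section \<open>Cells at heavy members\<close>

text \<open>Such a cell, a private edge at \<open>a\<close> and a private edge at \<open>b\<close>
  could be chosen disjoint and would replace \<open>A\<close> and \<open>B\<close>.\<close>

lemma T_heavy_heavy:
  assumes M: "A \<in> M" "B \<in> M" "A \<noteq> B" and a: "a \<in> A" "a \<in> Z" and b: "b \<in> B" "b \<in> Z"
  shows "T (A - {a}) (B - {b}) = {}"
proof (rule ccontr)
  assume "T (A - {a}) (B - {b}) \<noteq> {}"
  then obtain u v x where r: "u \<in> A" "u \<noteq> a" "v \<in> B" "v \<noteq> b" "R u v x" by (auto simp: T_def)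
  have disj: "A \<inter> B = {}" using M M_disjoint by auto
  have sub: "A \<subseteq> V" "B \<subseteq> V" using M M_subset_V by auto
  have xV: "x \<notin> V" "{u, v, x} \<in> F" using r by (auto simp: R_def)
  have p: "card (P a) \<ge> 5" "card (P b) \<ge> 5" using a b by (auto simp: Z_def)
  have "a \<notin> {x}" using xV a sub by auto
  then obtain e where e: "e \<in> P a" "e \<inter> {x} = {}" using private_avoiding[of "{x}" a] p by auto
  have eF: "e \<in> F" "e \<inter> V = {a}" using e by (auto simp: P_def)
  have fe: "finite e" "card e = 3" using eF finite_edge card_edge by auto
  have bne: "b \<notin> e" using eF b a disj sub by auto
  have "card (insert x e) \<le> 4" using fe by (simp add: card_insert_if)
  moreover have "b \<notin> insert x e" using bne xV b sub by auto
  ultimately obtain f where f: "f \<in> P b" "f \<inter> insert x e = {}"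
    using private_avoiding[of "insert x e" b] p fe by auto
  have fF: "f \<in> F" "f \<inter> V = {b}" using f by (auto simp: P_def)
  show False
    by (rule no_augmentation3[OF xV(2) eF(1) fF(1) M(1,2)])
      (use r e f eF fF a b xV sub disj in auto)
qed

text \<open>Only two rows remain. Disjoint cells in them must share their colour, since otherwise a
  private edge at \<open>a\<close> avoiding both colours completes an augmentation.\<close>

lemma T_heavy:
  assumes M: "A \<in> M" "B \<in> M" "A \<noteq> B" and a: "a \<in> A" "a \<in> Z"
  shows "card (T (A - {a}) B) \<le> 4"
proof (rule ccontr)
  assume big: "\<not> ?thesis"
  have disj: "A \<inter> B = {}" using M M_disjoint by auto
  have sub: "A \<subseteq> V" "B \<subseteq> V" using M M_subset_V by auto
  have cA: "card (A - {a}) = 2" and cB: "card B = 3" and fin: "finite A" "finite B"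
    using M M_subset card_edge finite_edge a by auto
  obtain b c where bc: "A - {a} = {b, c}" "b \<noteq> c" using cA by (auto simp: card_2_iff)
  have key: "d = d' \<or> x = x'" if R: "R u d x" "R u' d' x'" and m: "d \<in> B" "d' \<in> B" "u \<in> A - {a}" "u' \<in> A - {a}" "u \<noteq> u'"
    for u u' d d' x x'
  proof (rule ccontr)
    assume "\<not> ?thesis"
    then have ne: "d \<noteq> d'" "x \<noteq> x'" by auto
    have x: "x \<notin> V" "{u, d, x} \<in> F" "x' \<notin> V" "{u', d', x'} \<in> F" using R by (auto simp: R_def)
    have "card {x, x'} < card (P a)" using a by (auto simp: Z_def card_insert_if)
    moreover have "a \<notin> {x, x'}" using x a sub by auto
    ultimately obtain e where e: "e \<in> P a" "e \<inter> {x, x'} = {}"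
      using private_avoiding[of "{x, x'}" a] by blast
    have eF: "e \<in> F" "e \<inter> V = {a}" using e by (auto simp: P_def)
    have "u \<notin> e" "u' \<notin> e" "d \<notin> e" "d' \<notin> e" using eF m a sub disj by auto
    moreover have "x \<noteq> u'" "x \<noteq> d'" "u \<noteq> d'" "d \<noteq> u'" "d \<noteq> x'" "u \<noteq> x'" using x m sub disj by auto
    ultimately show False
      by (intro no_augmentation3[OF x(2) x(4) eF(1) M(1,2)])
        (use m e eF a x ne in auto)
  qed
  define D where "D u = {d \<in> B. \<exists>x. R u d x}" for u
  have "T (A - {a}) B = {b} \<times> D b \<union> {c} \<times> D c" unfolding T_def bc D_def by auto
  then have "card (T (A - {a}) B) = card (D b) + card (D c)"
    using bc(2) fin by (simp add: card_Un_disjoint card_cartesian_product D_def disjoint_iff)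
  then have D5: "card (D b) + card (D c) \<ge> 5" using big by simp
  have D3: "card (D u) \<le> 3" for u using card_mono[of B "D u"] fin cB by (auto simp: D_def)
  \<comment> \<open>Five coloured cells fill one row and put two into the other. The cell of the
    full row in the third column shares its colour with both, so these two have equal colours in one
    row, against \<open>R_inj\<close>.\<close>
  have contra: False if "card (D u) = 3" and D2: "card (D u') \<ge> 2" and "u \<in> A - {a}" "u' \<in> A - {a}" "u \<noteq> u'" for u u'
  proof -
    have "D u = B" using that fin cB by (intro card_seteq) (auto simp: D_def)
    obtain d1 d2 where d: "d1 \<in> D u'" "d2 \<in> D u'" "d1 \<noteq> d2"
      using D2 card_le_Suc0_iff_eq[of "D u'"] fin by (auto simp: D_def)
    have "card (B - {d1, d2}) \<ge> 1" using cB d fin diff_card_le_card_Diff[of "{d1, d2}" B] by simp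
    then obtain d3 where d3: "d3 \<in> B" "d3 \<noteq> d1" "d3 \<noteq> d2" by (cases "B - {d1, d2} = {}") auto
    obtain x3 where x3: "R u d3 x3" using d3 \<open>D u = B\<close> by (auto simp: D_def)
    obtain x1 x2 where x12: "R u' d1 x1" "R u' d2 x2" "d1 \<in> B" "d2 \<in> B" using d by (auto simp: D_def)
    have "x3 = x1" "x3 = x2" using key[OF x3 x12(1)] key[OF x3 x12(2)] x12 d3 that by auto
    then show False using R_inj x12 d by blast
  qed
  have m: "b \<in> A - {a}" "c \<in> A - {a}" using bc by auto
  show False
    using D5 D3[of b] D3[of c] contra[of b c] contra[of c b] bc m by (cases "card (D b) = 3") auto
qed

section \<open>Charging edges to pairs of members of the matching\<close>

definition T3 where
  "T3 A B = {(u, v). u \<in> A \<and> v \<in> B \<and> (\<exists>e\<in>F. e \<subseteq> V \<and> u \<in> e \<and> v \<in> e)}"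

lemma T3_subset: "T3 A B \<subseteq> A \<times> B"
  by (auto simp: T3_def)

lemma T_T3_disjoint: "A \<inter> B = {} \<Longrightarrow> T A B \<inter> T3 A B = {}"
proof (rule ccontr)
  assume AB: "A \<inter> B = {}" and "T A B \<inter> T3 A B \<noteq> {}"
  then obtain u v x e where r: "R u v x" "e \<in> F" "e \<subseteq> V" "u \<in> e" "v \<in> e"
    by (auto simp: T_def T3_def)
  then have "{u, v, x} = e" using R_neq[OF r(1)] by (intro edge_eqI[of _ _ u v]) (auto simp: R_def)
  then show False using r by (auto simp: R_def)
qed

text \<open>By linearity a cell lies on at most one edge, so it cannot be of both types.\<close>

lemma card_T_T3_le:
  assumes "A \<inter> B = {}" "finite A" "finite B"
  shows "card (T A B) + card (T3 A B) \<le> card A * card B"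
proof -
  have fin: "finite (T A B)" "finite (T3 A B)"
    using assms finite_subset[OF T_subset] finite_subset[OF T3_subset] by auto
  then have "card (T A B) + card (T3 A B) = card (T A B \<union> T3 A B)"
    using T_T3_disjoint[OF assms(1)] by (simp add: card_Un_disjoint)
  also have "\<dots> \<le> card (A \<times> B)"
    using T_subset T3_subset assms by (intro card_mono) auto
  finally show ?thesis by (simp add: card_cartesian_product)
qed

text \<open>Each edge yields \<open>k * (k - 1)\<close> ordered pairs of distinct vertices in
  \<open>V\<close>, and by linearity different edges yield different pairs. \<open>W\<close> will be
  \<open>T\<close> for \<open>k = 2\<close> and \<open>T3\<close> for \<open>k = 3\<close>, both
  restricted to the complement of \<open>Z\<close>.\<close>

lemma edge_pairs_count:
  assumes "E \<subseteq> F" and k: "\<And>e. e \<in> E \<Longrightarrow> card (e \<inter> V) = k"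
    and cover: "\<And>e u v. e \<in> E \<Longrightarrow> u \<in> e \<inter> V \<Longrightarrow> v \<in> e \<inter> V \<Longrightarrow> u \<noteq> v \<Longrightarrow>
      \<exists>A\<in>M. \<exists>B\<in>M - {A}. (u, v) \<in> W A B"
    and finW: "\<And>A B. A \<in> M \<Longrightarrow> B \<in> M \<Longrightarrow> finite (W A B)"
  shows "k * (k - 1) * card E \<le> (\<Sum>A\<in>M. \<Sum>B\<in>M - {A}. card (W A B))"
proof -
  define Q where "Q e = (e \<inter> V) \<times> (e \<inter> V) - Id_on (e \<inter> V)" for e
  have finE: "finite E" using assms(1) finF finite_subset by auto
  have "card (Q e) = k * (k - 1)" if "e \<in> E" for e
  proof -
    have "Id_on (e \<inter> V) = (\<lambda>x. (x, x)) ` (e \<inter> V)" by auto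
    then have "card (Id_on (e \<inter> V)) = k" using k[OF that] by (simp add: card_image inj_on_def)
    moreover have "finite (e \<inter> V)" using finite_V by simp
    moreover have "Id_on (e \<inter> V) \<subseteq> (e \<inter> V) \<times> (e \<inter> V)" by auto
    ultimately show ?thesis unfolding Q_def using k[OF that]
      by (subst card_Diff_subset) (auto simp: card_cartesian_product diff_mult_distrib2 intro: finite_subset)
  qed
  moreover have "Q e \<inter> Q f = {}" if "e \<in> E" "f \<in> E" "e \<noteq> f" for e f
  proof (rule ccontr)
    assume "Q e \<inter> Q f \<noteq> {}"
    then obtain u v where "u \<noteq> v" "u \<in> e" "v \<in> e" "u \<in> f" "v \<in> f" by (auto simp: Q_def Id_on_iff)
    then show False using that edge_eqI[of e f u v] assms(1) by blast
  qed
  moreover have "finite (Q e)" for e using finite_V by (simp add: Q_def)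
  ultimately have "card (\<Union>e\<in>E. Q e) = card E * (k * (k - 1))"
    using finE by (subst card_UN_disjoint) auto
  moreover have "(\<Union>e\<in>E. Q e) \<subseteq> (\<Union>A\<in>M. \<Union>B\<in>M - {A}. W A B)"
    using cover by (fastforce simp: Q_def)
  then have "card (\<Union>e\<in>E. Q e) \<le> card (\<Union>A\<in>M. \<Union>B\<in>M - {A}. W A B)"
    using finite_M finW by (intro card_mono) auto
  moreover have "card (\<Union>A\<in>M. \<Union>B\<in>M - {A}. W A B) \<le> (\<Sum>A\<in>M. card (\<Union>B\<in>M - {A}. W A B))"
    by (rule card_UN_le[OF finite_M])
  moreover have "\<dots> \<le> (\<Sum>A\<in>M. \<Sum>B\<in>M - {A}. card (W A B))"
    using finite_M by (intro sum_mono card_UN_le) auto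
  ultimately show ?thesis by (simp add: mult.commute)
qed

lemma edge_meets_V: assumes "e \<in> F" shows "card (e \<inter> V) \<in> {1, 2, 3}"
proof -
  have "e \<inter> V \<noteq> {}"
  proof
    assume "e \<inter> V = {}"
    \<comment> \<open>Augmentation with nothing removed: \<open>e\<close> could simply be added to
      \<open>M\<close>.\<close>
    then have "card {e} \<le> card ({} :: 'a set set)" using assms by (intro no_augmentation) auto
    then show False by simp
  qed
  moreover have "finite e" "card e = 3" using assms finite_edge card_edge by auto
  moreover have "card (e \<inter> V) \<le> card e" using \<open>finite e\<close> by (intro card_mono) auto
  ultimately have "card (e \<inter> V) \<noteq> 0" "card (e \<inter> V) \<le> 3" by auto
  then show ?thesis by auto
qed

lemma ends_in_distinct_M:
  assumes "e \<in> F" "e \<notin> M" "u \<in> e \<inter> V" "v \<in> e \<inter> V" "u \<noteq> v"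
  obtains A B where "A \<in> M" "B \<in> M" "A \<noteq> B" "u \<in> A" "v \<in> B"
proof -
  obtain A B where AB: "A \<in> M" "B \<in> M" "u \<in> A" "v \<in> B" using assms by (auto simp: V_def)
  have "A \<noteq> B" using edge_eqI[of e A u v] assms AB M_subset by auto
  then show thesis using that AB by blast
qed

section \<open>Heavy and light members and the final count\<close>

definition H where "H = {A \<in> M. A \<inter> Z \<noteq> {}}"
definition L where "L = {A \<in> M. A \<inter> Z = {}}"

lemma M_split: "M = H \<union> L" "H \<inter> L = {}" "finite H" "finite L"
  using finite_M by (auto simp: H_def L_def)

lemma sum_M_split: "sum g M = sum g H + sum g L" for g :: "'a set \<Rightarrow> nat"
proof -
  have "sum g M = sum g (H \<union> L)" by (rule arg_cong[OF M_split(1)])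
  also have "\<dots> = sum g H + sum g L" by (rule sum.union_disjoint[OF M_split(3,4,2)])
  finally show ?thesis .
qed

lemma card_Z_le: "card Z \<le> card H"
proof -
  have "Z \<subseteq> (\<Union>A\<in>H. A \<inter> Z)" by (auto simp: H_def Z_def V_def)
  then have "card Z \<le> card (\<Union>A\<in>H. A \<inter> Z)"
    by (intro card_mono finite_subset[OF _ finite_V]) (auto simp: Z_def)
  also have "\<dots> \<le> (\<Sum>A\<in>H. card (A \<inter> Z))" by (rule card_UN_le[OF M_split(3)])
  also have "\<dots> \<le> (\<Sum>A\<in>H. 1)" using card_M_Z_le_1 by (intro sum_mono) (auto simp: H_def)
  finally show ?thesis by simp
qed

text \<open>Heavy members contain a vertex of \<open>Z\<close>, and all their private edges are at
  that vertex. So only light members matter, each with itself and at most 6 private edges.\<close>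

lemma card_edges_light:
  "card {e \<in> F. e \<inter> Z = {} \<and> (e \<in> M \<or> card (e \<inter> V) = 1)} \<le> 7 * card L"
proof -
  have "{e \<in> F. e \<inter> Z = {} \<and> (e \<in> M \<or> card (e \<inter> V) = 1)} \<subseteq> L \<union> (\<Union>A\<in>L. \<Union>u\<in>A. P u)"
  proof
    fix e assume "e \<in> {e \<in> F. e \<inter> Z = {} \<and> (e \<in> M \<or> card (e \<inter> V) = 1)}"
    then have e: "e \<in> F" "e \<inter> Z = {}" "e \<in> M \<or> card (e \<inter> V) = 1" by auto
    show "e \<in> L \<union> (\<Union>A\<in>L. \<Union>u\<in>A. P u)"
    proof (cases "e \<in> M")
      case True then show ?thesis using e by (auto simp: L_def)
    next
      case False
      then obtain u where u: "e \<inter> V = {u}" using e by (auto simp: card_1_singleton_iff)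
      then obtain A where A: "A \<in> M" "u \<in> A" by (auto simp: V_def)
      have "e \<in> P u" using u e by (auto simp: P_def)
      moreover have "u \<notin> Z" using u e by auto
      ultimately have "A \<in> L" using private_heavy[OF A(1) _ A(2)] A by (auto simp: L_def)
      then show ?thesis using A \<open>e \<in> P u\<close> by auto
    qed
  qed
  then have "card {e \<in> F. e \<inter> Z = {} \<and> (e \<in> M \<or> card (e \<inter> V) = 1)} \<le> card (L \<union> (\<Union>A\<in>L. \<Union>u\<in>A. P u))"
    using M_split M_subset finite_edge finite_P by (intro card_mono) (auto simp: L_def)
  also have "\<dots> \<le> card L + card (\<Union>A\<in>L. \<Union>u\<in>A. P u)" by (rule card_Un_le)
  also have "card (\<Union>A\<in>L. \<Union>u\<in>A. P u) \<le> (\<Sum>A\<in>L. card (\<Union>u\<in>A. P u))" by (rule card_UN_le[OF M_split(4)])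
  also have "\<dots> \<le> (\<Sum>A\<in>L. \<Sum>u\<in>A. card (P u))"
    using M_subset finite_edge by (intro sum_mono card_UN_le) (auto simp: L_def)
  also have "\<dots> \<le> (\<Sum>A\<in>L. 6)" by (intro sum_mono private_light) (auto simp: L_def)
  finally show ?thesis by simp
qed

text \<open>An edge with two vertices in \<open>V\<close> is seen by 2 ordered pairs of members of \<open>M\<close> and an edge
  with three vertices in \<open>V\<close> by 6, so the weights add up to 6 for each edge.\<close>

definition weight where
  "weight A B = 3 * card (T (A - Z) (B - Z)) + card (T3 (A - Z) (B - Z))"

lemma card_edges_two_three:
  "6 * card {e \<in> F. e \<inter> Z = {} \<and> e \<notin> M \<and> card (e \<inter> V) \<noteq> 1} \<le> (\<Sum>A\<in>M. \<Sum>B\<in>M - {A}. weight A B)"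
proof -
  define E where "E k = {e \<in> F. e \<inter> Z = {} \<and> e \<notin> M \<and> card (e \<inter> V) = k}" for k
  have fin: "finite (T (A - Z) (B - Z))" "finite (T3 (A - Z) (B - Z))" if "A \<in> M" "B \<in> M" for A B
  proof -
    have "finite ((A - Z) \<times> (B - Z))" using that M_subset finite_edge by auto
    then show "finite (T (A - Z) (B - Z))" "finite (T3 (A - Z) (B - Z))"
      using finite_subset[OF T_subset] finite_subset[OF T3_subset] by blast+
  qed
  have "2 * (2 - 1) * card (E 2) \<le> (\<Sum>A\<in>M. \<Sum>B\<in>M - {A}. card (T (A - Z) (B - Z)))"
  proof (rule edge_pairs_count)
    fix e u v assume e: "e \<in> E 2" "u \<in> e \<inter> V" "v \<in> e \<inter> V" "u \<noteq> v"
    then have e': "e \<in> F" "e \<notin> M" "e \<inter> Z = {}" "card (e \<inter> V) = 2" by (auto simp: E_def)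
    obtain A B where AB: "A \<in> M" "B \<in> M" "A \<noteq> B" "u \<in> A" "v \<in> B"
      using ends_in_distinct_M[OF e'(1,2) e(2-4)] .
    have "{u, v} = e \<inter> V" using e e' finite_V by (intro card_subset_eq) auto
    moreover have "card (e - {u, v}) = 1"
      using e card_edge[OF e'(1)] by (subst card_Diff_subset) auto
    then obtain x where x: "e - {u, v} = {x}" by (auto simp: card_1_singleton_iff)
    ultimately have "x \<notin> V" "e = {u, v, x}" using e by auto
    then have "R u v x" using e e' by (auto simp: R_def)
    then have "(u, v) \<in> T (A - Z) (B - Z)" using AB e e' by (auto simp: T_def)
    then show "\<exists>A\<in>M. \<exists>B\<in>M - {A}. (u, v) \<in> T (A - Z) (B - Z)" using AB by blast
  qed (use fin in \<open>auto simp: E_def\<close>)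
  moreover have "3 * (3 - 1) * card (E 3) \<le> (\<Sum>A\<in>M. \<Sum>B\<in>M - {A}. card (T3 (A - Z) (B - Z)))"
  proof (rule edge_pairs_count)
    fix e u v assume e: "e \<in> E 3" "u \<in> e \<inter> V" "v \<in> e \<inter> V" "u \<noteq> v"
    then have e': "e \<in> F" "e \<notin> M" "e \<inter> Z = {}" "card (e \<inter> V) = 3" by (auto simp: E_def)
    obtain A B where AB: "A \<in> M" "B \<in> M" "A \<noteq> B" "u \<in> A" "v \<in> B"
      using ends_in_distinct_M[OF e'(1,2) e(2-4)] .
    have "e \<inter> V = e" using e' card_edge finite_edge by (intro card_subset_eq) auto
    then have "e \<subseteq> V" by blast
    moreover have "u \<in> A - Z" "v \<in> B - Z" using AB e e'(3) by blast+
    ultimately have "(u, v) \<in> T3 (A - Z) (B - Z)" using e(2,3) e'(1) unfolding T3_def by blast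
    then show "\<exists>A\<in>M. \<exists>B\<in>M - {A}. (u, v) \<in> T3 (A - Z) (B - Z)" using AB by blast
  qed (use fin in \<open>auto simp: E_def\<close>)
  moreover have "{e \<in> F. e \<inter> Z = {} \<and> e \<notin> M \<and> card (e \<inter> V) \<noteq> 1} = E 2 \<union> E 3"
    using edge_meets_V by (auto simp: E_def)
  moreover have "card (E 2 \<union> E 3) \<le> card (E 2) + card (E 3)" by (rule card_Un_le)
  ultimately show ?thesis
    by (simp add: weight_def sum.distrib sum_distrib_left[symmetric])
qed

lemma card_minus_Z:
  assumes "A \<in> H" obtains a where "a \<in> A" "a \<in> Z" "A - Z = A - {a}" "card (A - Z) = 2"
proof -
  have A: "A \<in> M" "A \<inter> Z \<noteq> {}" using assms by (auto simp: H_def)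
  then obtain a where a: "a \<in> A" "a \<in> Z" by blast
  have "finite (A \<inter> Z)" "card A = 3" using A M_subset finite_edge card_edge by auto
  then have "A \<inter> Z = {a}"
    using card_M_Z_le_1[OF A(1)] a card_le_Suc0_iff_eq[of "A \<inter> Z"] by auto
  then have "A - Z = A - {a}" by auto
  then show thesis using that a \<open>card A = 3\<close> by simp
qed

lemma weight_heavy_heavy:
  assumes "A \<in> H" "B \<in> H" "A \<noteq> B" shows "weight A B \<le> 4"
proof -
  obtain a where a: "a \<in> A" "a \<in> Z" "A - Z = A - {a}" "card (A - Z) = 2" using card_minus_Z[OF assms(1)] .
  obtain b where b: "b \<in> B" "b \<in> Z" "B - Z = B - {b}" "card (B - Z) = 2" using card_minus_Z[OF assms(2)] .
  have M: "A \<in> M" "B \<in> M" using assms by (auto simp: H_def)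
  have "T (A - Z) (B - Z) = {}" using T_heavy_heavy[OF M assms(3) a(1,2) b(1,2)] a b by simp
  moreover have "card (T (A - Z) (B - Z)) + card (T3 (A - Z) (B - Z)) \<le> card (A - Z) * card (B - Z)"
    using M_disjoint[OF M assms(3)] M M_subset finite_edge by (intro card_T_T3_le) auto
  ultimately show ?thesis using a b by (simp add: weight_def)
qed

lemma weight_sym: "weight A B = weight B A"
proof -
  have "T3 (B - Z) (A - Z) = (T3 (A - Z) (B - Z))\<inverse>" unfolding T3_def by blast
  then have "card (T3 (B - Z) (A - Z)) = card (T3 (A - Z) (B - Z))" by (simp add: card_inverse)
  then show ?thesis unfolding weight_def using card_T_sym[of "A - Z" "B - Z"] by simp
qed

text \<open>The weight is twice the number of cells in \<open>T\<close> plus the number in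
  \<open>T\<close> and \<open>T3\<close> together, at most 2 * 4 + 6.\<close>

lemma weight_heavy_light:
  assumes "A \<in> H" "B \<in> L" shows "weight A B \<le> 14"
proof -
  obtain a where a: "a \<in> A" "a \<in> Z" "A - Z = A - {a}" "card (A - Z) = 2" using card_minus_Z[OF assms(1)] .
  have M: "A \<in> M" "B \<in> M" "A \<noteq> B" and B: "B - Z = B" using assms by (auto simp: H_def L_def)
  have "card (T (A - Z) (B - Z)) \<le> 4" using T_heavy[OF M a(1,2)] a B by simp
  moreover have "card (T (A - Z) (B - Z)) + card (T3 (A - Z) (B - Z)) \<le> card (A - Z) * card (B - Z)"
    using M_disjoint[OF M] M M_subset finite_edge by (intro card_T_T3_le) auto
  moreover have "card B = 3" using M M_subset card_edge by auto
  ultimately show ?thesis using a B by (simp add: weight_def)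
qed

text \<open>The same splitting over nine cells. An average of 7 for \<open>card (T A B)\<close>
  turns this into 9 + 14 = 23, the constant of the theorem.\<close>

lemma weight_light_light:
  assumes "A \<in> L" "B \<in> L" "A \<noteq> B" shows "weight A B \<le> 9 + 2 * card (T A B)"
proof -
  have M: "A \<in> M" "B \<in> M" and Z: "A - Z = A" "B - Z = B" using assms by (auto simp: L_def)
  have "card (T A B) + card (T3 A B) \<le> card A * card B"
    using M_disjoint[OF M assms(3)] M M_subset finite_edge by (intro card_T_T3_le) auto
  moreover have "card A = 3" "card B = 3" using M M_subset card_edge by auto
  ultimately show ?thesis by (simp add: weight_def Z)
qed

text \<open>Heavy-light pairs count in both orders, giving 28 = 2 * 14. The final 4 is twice the
  slack 2 of \<open>sum_pairs_le_of_triples\<close>.\<close>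

lemma sum_weight_le:
  "(\<Sum>A\<in>M. \<Sum>B\<in>M - {A}. weight A B) \<le>
    4 * card H * (card H - 1) + 28 * card H * card L + 23 * card L * (card L - 1) + 4"
proof -
  have "(\<Sum>B\<in>M - {A}. weight A B) \<le> 4 * (card H - 1) + 14 * card L" if "A \<in> H" for A
  proof -
    have "M - {A} = (H - {A}) \<union> L" using that M_split by auto
    then have "(\<Sum>B\<in>M - {A}. weight A B) = (\<Sum>B\<in>H - {A}. weight A B) + (\<Sum>B\<in>L. weight A B)"
      using M_split by (simp add: sum.union_disjoint disjoint_iff)
    also have "(\<Sum>B\<in>H - {A}. weight A B) \<le> (\<Sum>B\<in>H - {A}. 4)"
      using that by (intro sum_mono weight_heavy_heavy) auto
    also have "(\<Sum>B\<in>L. weight A B) \<le> (\<Sum>B\<in>L. 14)"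
      using that by (intro sum_mono weight_heavy_light) auto
    finally show ?thesis using that M_split by simp
  qed
  then have "(\<Sum>A\<in>H. \<Sum>B\<in>M - {A}. weight A B) \<le> (\<Sum>A\<in>H. 4 * (card H - 1) + 14 * card L)"
    by (intro sum_mono) auto
  then have 1: "(\<Sum>A\<in>H. \<Sum>B\<in>M - {A}. weight A B) \<le> 4 * card H * (card H - 1) + 14 * card H * card L"
    by (simp add: algebra_simps)
  have "(\<Sum>B\<in>M - {A}. weight A B) \<le> 14 * card H + 9 * (card L - 1) + 2 * (\<Sum>B\<in>L - {A}. card (T A B))" if "A \<in> L" for A
  proof -
    have "M - {A} = H \<union> (L - {A})" using that M_split by auto
    then have "(\<Sum>B\<in>M - {A}. weight A B) = (\<Sum>B\<in>H. weight A B) + (\<Sum>B\<in>L - {A}. weight A B)"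
      using M_split by (simp add: sum.union_disjoint disjoint_iff)
    also have "(\<Sum>B\<in>H. weight A B) \<le> (\<Sum>B\<in>H. 14)"
      using that weight_heavy_light by (subst weight_sym) (intro sum_mono, auto)
    also have "(\<Sum>B\<in>L - {A}. weight A B) \<le> (\<Sum>B\<in>L - {A}. 9 + 2 * card (T A B))"
      using that by (intro sum_mono weight_light_light) auto
    finally show ?thesis using that M_split by (simp add: sum.distrib sum_distrib_left)
  qed
  then have "(\<Sum>A\<in>L. \<Sum>B\<in>M - {A}. weight A B) \<le>
    (\<Sum>A\<in>L. 14 * card H + 9 * (card L - 1) + 2 * (\<Sum>B\<in>L - {A}. card (T A B)))"
    by (intro sum_mono) auto
  also have "\<dots> = 14 * card H * card L + 9 * card L * (card L - 1) + 2 * (\<Sum>A\<in>L. \<Sum>B\<in>L - {A}. card (T A B))"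
    by (simp add: sum.distrib sum_distrib_left[symmetric] distrib_left mult.commute mult.left_commute)
  also have "(\<Sum>A\<in>L. \<Sum>B\<in>L - {A}. card (T A B)) \<le> 7 * card L * (card L - 1) + 2"
    using M_split card_T_sym card_T_le_8 card_T_triple
    by (intro sum_pairs_le_of_triples) (auto simp: L_def)
  finally have 2: "(\<Sum>A\<in>L. \<Sum>B\<in>M - {A}. weight A B) \<le> 14 * card H * card L + 23 * card L * (card L - 1) + 4"
    by simp
  have "(\<Sum>A\<in>M. \<Sum>B\<in>M - {A}. weight A B) =
    (\<Sum>A\<in>H. \<Sum>B\<in>M - {A}. weight A B) + (\<Sum>A\<in>L. \<Sum>B\<in>M - {A}. weight A B)"
    by (rule sum_M_split)
  then show ?thesis using 1 2 by simp
qed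

lemma card_F_le:
  assumes deg: "\<And>x. card (star F x) \<le> 3 * card M"
  shows "6 * card F \<le> 23 * card M * (card M + 1)"
proof (cases "M = {}")
  case True
  have "F = {}"
  proof (rule ccontr)
    assume "F \<noteq> {}"
    then obtain e where "e \<in> F" by blast
    moreover have "V = {}" unfolding V_def using True by simp
    ultimately show False using edge_meets_V[of e] by simp
  qed
  then show ?thesis by simp
next
  case False
  define F1 where "F1 = {e \<in> F. e \<inter> Z \<noteq> {}}"
  define F2 where "F2 = {e \<in> F. e \<inter> Z = {} \<and> (e \<in> M \<or> card (e \<inter> V) = 1)}"
  define F3 where "F3 = {e \<in> F. e \<inter> Z = {} \<and> e \<notin> M \<and> card (e \<inter> V) \<noteq> 1}"
  have finZ: "finite Z" using finite_V by (auto simp: Z_def)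
  have "F1 \<subseteq> (\<Union>z\<in>Z. star F z)" by (auto simp: F1_def star_def)
  then have "card F1 \<le> card (\<Union>z\<in>Z. star F z)"
    using finZ finF by (intro card_mono) (auto simp: star_def)
  also have "\<dots> \<le> (\<Sum>z\<in>Z. card (star F z))" by (rule card_UN_le[OF finZ])
  also have "\<dots> \<le> (\<Sum>z\<in>Z. 3 * card M)" by (intro sum_mono deg)
  also have "\<dots> \<le> card H * (3 * card M)" using card_Z_le by simp
  finally have c1: "card F1 \<le> card H * (3 * card M)" .
  have c2: "card F2 \<le> 7 * card L" unfolding F2_def by (rule card_edges_light)
  have c3: "6 * card F3 \<le> 4 * card H * (card H - 1) + 28 * card H * card L + 23 * card L * (card L - 1) + 4"
    using card_edges_two_three sum_weight_le unfolding F3_def by linarith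
  have "F = F1 \<union> F2 \<union> F3" by (auto simp: F1_def F2_def F3_def)
  then have "card F \<le> card F1 + card F2 + card F3"
    using card_Un_le[of F1 F2] card_Un_le[of "F1 \<union> F2" F3] by simp
  then have tot: "6 * card F \<le> 18 * card H * card M + 42 * card L + 4 * card H * (card H - 1)
      + 28 * card H * card L + 23 * card L * (card L - 1) + 4"
    using c1 c2 c3 by simp
  have n: "card M = card H + card L" using sum_M_split[of "\<lambda>_. 1"] by simp
  have "card M \<ge> 1" using False finite_M by (simp add: Suc_leI card_gt_0_iff)
  define p where "p = 4 * card H * (card H - 1)"
  define q where "q = 23 * card L * (card L - 1)"
  have "p \<le> 4 * card H * card H" by (simp add: p_def)
  moreover have "q + 23 * card L = 23 * card L * card L"
    by (cases "card L") (auto simp: q_def algebra_simps)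
  moreover have "6 * card F \<le> 18 * card H * card M + 42 * card L + p + 28 * card H * card L + q + 4"
    using tot by (simp add: p_def q_def)
  \<comment> \<open>With \<open>h\<close> heavy and \<open>l\<close> light members the right side
    exceeds the bound obtained by at least \<open>h^2 + 23 * h + 4 * l - 4\<close>, which is
    nonnegative as soon as \<open>M\<close> is nonempty. Naming \<open>p\<close> and
    \<open>q\<close> removes the truncated subtractions.\<close>
  ultimately show ?thesis using \<open>card M \<ge> 1\<close> unfolding n by (simp add: algebra_simps)
qed

end

section \<open>Induction by deleting vertices of high degree\<close>

text \<open>\<open>N\<close> covers at most \<open>3 * card N\<close> vertices, none of them
  \<open>x\<close>. By linearity each lies on at most one edge through \<open>x\<close>, so some
  edge through \<open>x\<close> avoids \<open>N\<close>.\<close>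

lemma vertex_deletion_matching:
  assumes "finite F" "uniform3 F" "linear_sys F" and N: "is_matching (F - star F x) N"
    and deg: "card (star F x) > 3 * card N"
  shows "\<exists>e\<in>star F x. is_matching F (insert e N) \<and> e \<notin> N"
proof -
  have NF: "N \<subseteq> F" "x \<notin> \<Union>N" using N by (auto simp: is_matching_def star_def)
  have fin: "finite e" "card e = 3" if "e \<in> F" for e
    using that assms(2) by (auto simp: uniform3_def intro: card_ge_0_finite)
  have finU: "finite (\<Union>N)" using NF assms(1) fin finite_subset by (metis finite_Union subsetD)
  have "card (\<Union>N) \<le> (\<Sum>A\<in>N. card A)" by (rule card_Union_le_sum_card)
  also have "\<dots> = 3 * card N" using NF fin by (simp add: subset_iff)
  finally have "card (\<Union>N) < card (star F x)" using deg by simp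
  have "\<exists>e\<in>star F x. e \<inter> \<Union>N = {}"
  proof (rule ccontr)
    assume "\<not> ?thesis"
    then have "\<forall>e\<in>star F x. \<exists>s. s \<in> e \<inter> \<Union>N" by blast
    then obtain g where g: "\<And>e. e \<in> star F x \<Longrightarrow> g e \<in> e \<inter> \<Union>N" by metis
    have "inj_on g (star F x)"
    proof (rule inj_onI, rule ccontr)
      fix e f assume ef: "e \<in> star F x" "f \<in> star F x" "g e = g f" "e \<noteq> f"
      have "{x, g e} \<subseteq> e \<inter> f" "x \<noteq> g e" using ef g[of e] g[of f] NF by (auto simp: star_def)
      then have "2 \<le> card (e \<inter> f)" using card_mono[of "e \<inter> f" "{x, g e}"] fin ef by (auto simp: star_def)
      moreover have "card (e \<inter> f) \<le> 1" using ef assms(3) by (auto simp: linear_sys_def star_def)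
      ultimately show False by simp
    qed
    then have "card (star F x) \<le> card (\<Union>N)" using g finU by (intro card_inj_on_le[of g]) auto
    then show False using \<open>card (\<Union>N) < card (star F x)\<close> by simp
  qed
  then obtain e where e: "e \<in> star F x" "e \<inter> \<Union>N = {}" by blast
  then have "is_matching F (insert e N)" using N by (auto simp: is_matching_def star_def)
  moreover have "e \<notin> N" using NF e by (auto simp: star_def)
  ultimately show ?thesis using e by blast
qed

text \<open>Only upper bounds \<open>n\<close> and \<open>\<Delta>\<close> are assumed, so that they
  pass to subsystems; the last hypothesis weakens as \<open>n\<close> decreases. Deleting a star
  costs at most \<open>\<Delta>\<close> edges and lowers \<open>n\<close> by one. If no degree
  exceeds three times the matching number, \<open>card_F_le\<close> applies.\<close>

lemma card_le_degree_times_matching: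
  assumes "finite F" "uniform3 F" "linear_sys F"
    and "\<And>N. is_matching F N \<Longrightarrow> card N \<le> n"
    and "\<And>x. card (star F x) \<le> \<Delta>" and "6 * \<Delta> \<ge> 23 * (n + 1)"
  shows "card F \<le> n * \<Delta>"
  using assms
proof (induction n arbitrary: F)
  case 0
  have "F = {}"
  proof (rule ccontr)
    assume "F \<noteq> {}"
    then obtain e where "e \<in> F" by blast
    then have "is_matching F {e}" by (auto simp: is_matching_def)
    then show False using 0(4) by force
  qed
  then show ?case by simp
next
  case (Suc n)
  consider (small) "\<And>N. is_matching F N \<Longrightarrow> card N \<le> n"
    | (deg) x where "card (star F x) > 3 * Suc n"
    | (core) M where "is_matching F M" "card M = Suc n" "\<And>x. card (star F x) \<le> 3 * Suc n"
  proof (cases "\<exists>M. is_matching F M \<and> card M = Suc n")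
    case True
    then show thesis using core deg not_le by blast
  next
    case False
    have "card N \<le> n" if "is_matching F N" for N
      using Suc.prems(4)[OF that] False that le_Suc_eq by blast
    then show thesis by (rule small)
  qed
  then show ?case
  proof cases
    case small
    then have "card F \<le> n * \<Delta>" using Suc.prems by (intro Suc.IH) auto
    then show ?thesis by simp
  next
    case deg
    let ?F = "F - star F x"
    have star_mono: "star ?F y \<subseteq> star F y" for y by (auto simp: star_def)
    have "card ?F \<le> n * \<Delta>"
    proof (rule Suc.IH)
      show "uniform3 ?F" "linear_sys ?F" using Suc.prems by (auto simp: uniform3_def linear_sys_def)
      show "card (star ?F y) \<le> \<Delta>" for y
      proof -
        have "finite (star F y)" using Suc.prems(1) by (simp add: star_def)
        then show ?thesis using card_mono[OF _ star_mono] Suc.prems(5) le_trans by blast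
      qed
      show "card N \<le> n" if N: "is_matching ?F N" for N
      proof (rule ccontr)
        assume "\<not> card N \<le> n"
        have "is_matching F N" using N by (auto simp: is_matching_def)
        then have "card N = Suc n" using Suc.prems(4) \<open>\<not> card N \<le> n\<close> by (metis le_SucE)
        then obtain e where "is_matching F (insert e N)" "e \<notin> N"
          using vertex_deletion_matching[OF Suc.prems(1-3) N] deg by auto
        moreover have "finite N" using \<open>card N = Suc n\<close> by (metis card.infinite nat.distinct(1))
        ultimately show False using Suc.prems(4)[of "insert e N"] \<open>card N = Suc n\<close> by simp
      qed
    qed (use Suc.prems in auto)
    moreover have "card F \<le> card ?F + card (star F x)"
      using card_Un_le[of ?F "star F x"] by (simp add: star_def Un_absorb2 subset_iff)
    ultimately show ?thesis using Suc.prems(5)[of x] by simp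
  next
    case core
    interpret maximum_matching F M
      using Suc.prems core by unfold_locales auto
    have "6 * card F \<le> 23 * card M * (card M + 1)" using card_F_le core by simp
    also have "\<dots> = Suc n * (23 * (Suc n + 1))" using core by (simp add: algebra_simps)
    also have "\<dots> \<le> Suc n * (6 * \<Delta>)" using Suc.prems(6) by (intro mult_le_mono2)
    finally show ?thesis by simp
  qed
qed

theorem theorem2:
  fixes F :: "'a set set" and \<nu> \<Delta> :: nat
  assumes "finite F"
    and "uniform3 F"
    and "linear_sys F"
    and "matching_number F = \<nu>"
    and "max_degree F = \<Delta>"
    and "\<nu> \<ge> 2"
    and "real \<Delta> \<ge> 23 / 6 * real \<nu> * (1 + 1 / (real \<nu> - 1))"
  shows "card F \<le> \<Delta> * \<nu>"
proof -
  have "{card N | N. is_matching F N} \<subseteq> {..card F}"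
    using assms(1) by (auto simp: is_matching_def card_mono)
  \<comment> \<open>Finiteness is what lets \<open>Max\<close> bound the members of the set.\<close>
  then have "finite {card N | N. is_matching F N}" by (rule finite_subset) simp
  then have m: "card N \<le> \<nu>" if "is_matching F N" for N
    using that assms(4) unfolding matching_number_def by (auto intro: Max_ge)
  have "{card (star F x) | x. True} \<union> {0} \<subseteq> {..card F}"
    using assms(1) by (auto simp: star_def card_mono)
  then have "finite ({card (star F x) | x. True} \<union> {0})" by (rule finite_subset) simp
  then have d: "card (star F x) \<le> \<Delta>" for x
    using assms(5) unfolding max_degree_def by (auto intro: Max_ge)
  \<comment> \<open>Dropping the fraction from this form of the hypothesis leaves the integer
    inequality needed for the induction.\<close>
  have "real \<nu> * (1 + 1 / (real \<nu> - 1)) = real \<nu> + 1 + 1 / (real \<nu> - 1)"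
    using assms(6) by (simp add: field_simps)
  also have "\<dots> \<ge> real \<nu> + 1" using assms(6) by simp
  finally have "6 * real \<Delta> \<ge> 23 * (real \<nu> + 1)" using assms(7) by (simp add: mult.assoc)
  then have "real (23 * (\<nu> + 1)) \<le> real (6 * \<Delta>)" by simp
  then have "6 * \<Delta> \<ge> 23 * (\<nu> + 1)" by (simp only: of_nat_le_iff)
  then show ?thesis
    using card_le_degree_times_matching[OF assms(1-3) m d] by (simp add: mult.commute)
qed

end
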